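(* Let $(\mathcal{M},\phi,\xi,\eta,g)$ be a Riemannian $\Pi$-manifold. An affine connection $D$ on $\mathcal{M}$ is a natural connection on $(\mathcal{M},\phi,\xi,\eta,g)$ if and only if $D\phi=0$ and $Dg=0$.
   Context: A Riemannian $\Pi$-manifold $(\mathcal{M},\phi,\xi,\eta,g)$ is a $(2n+1)$-dimensional smooth manifold $\mathcal{M}$ with a Riemannian metric $g$, a $(1,1)$-tensor field $\phi$, a vector field $\xi$ and a 1-form $\eta$ such that $$\phi\xi=0,\quad \phi^2=I-\eta\otimes\xi,\quad \eta\circ\phi=0,\quad \eta(\xi)=1,\quad \operatorname{tr}\phi=0,\quad g(\phi x,\phi y)=g(x,y)-\eta(x)\eta(y).$$ Consequently $g(\phi x,y)=g(x,\phi y)$ and $g(x,\xi)=\eta(x)$. An affine connection $D$ on a Riemannian $\Pi$-manifold is called a natural connection if $D\phi=0$, $D\xi=0$, $D\eta=0$ and $Dg=0$. *)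

theory Defs
  imports "HOL-Analysis.Analysis" "HOL-Library.Function_Algebras"
begin

instantiation "fun" :: (type, real_vector) real_vector
begin

definition scaleR_fun :: "real \<Rightarrow> ('a \<Rightarrow> 'b) \<Rightarrow> 'a \<Rightarrow> 'b"
  where "scaleR_fun r f = (\<lambda>x. r *\<^sub>R f x)"

instance
  by standard (auto simp: scaleR_fun_def fun_eq_iff algebra_simps)

end

text \<open>
  The manifold is the whole type \<open>'a\<close>, which carries the topology. Charts are pairs
  \<open>(U, c)\<close>; the atlas \<open>A\<close> need not be maximal, since every notion below depends only on the
  smooth structure that \<open>A\<close> generates.
\<close>

text \<open>\<open>Ck_on k f S\<close>: \<open>f\<close> is of class \<open>C\<^sup>k\<close> on \<open>S\<close>. Only meaningful for open \<open>S\<close>.\<close>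

primrec Ck_on ::
    "nat \<Rightarrow> ('e::euclidean_space \<Rightarrow> 'f::real_normed_vector) \<Rightarrow> 'e set \<Rightarrow> bool" where
  "Ck_on 0 f S \<longleftrightarrow> continuous_on S f"
| "Ck_on (Suc k) f S \<longleftrightarrow>
     (\<forall>x\<in>S. f differentiable (at x)) \<and>
     (\<forall>v. Ck_on k (\<lambda>x. frechet_derivative f (at x) v) S)"

definition Cinf_on ::
    "('e::euclidean_space \<Rightarrow> 'f::real_normed_vector) \<Rightarrow> 'e set \<Rightarrow> bool" where
  "Cinf_on f S \<longleftrightarrow> (\<forall>k. Ck_on k f S)"

locale smooth_manifold =
  fixes A :: "('a::{t2_space, second_countable_topology} set \<times> ('a \<Rightarrow> 'e::euclidean_space)) set"
  assumes chart:
      "(U, c) \<in> A \<Longrightarrow> open U \<and> open (c ` U) \<and> homeomorphism U (c ` U) c (inv_into U c)"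
    and cover: "(\<Union>(U, c)\<in>A. U) = UNIV"
    and compatible:
      "(U, c) \<in> A \<Longrightarrow> (V, d) \<in> A \<Longrightarrow> Cinf_on (d \<circ> inv_into U c) (c ` (U \<inter> V))"

definition smooth_functions ::
    "('a set \<times> ('a \<Rightarrow> 'e::euclidean_space)) set \<Rightarrow> ('a \<Rightarrow> real) set" where
  "smooth_functions A = {f. \<forall>(U, c)\<in>A. Cinf_on (f \<circ> inv_into U c) (c ` U)}"

text \<open>
  A tangent vector at \<open>p\<close> is a derivation at \<open>p\<close> of the algebra of smooth functions. Setting it to
  \<open>0\<close> off that algebra makes equality of tangent vectors coincide with equality in HOL.
\<close>

type_synonym 'a tvec = "('a \<Rightarrow> real) \<Rightarrow> real"

definition tangent_space ::
    "('a set \<times> ('a \<Rightarrow> 'e::euclidean_space)) set \<Rightarrow> 'a \<Rightarrow> 'a tvec set" where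
  "tangent_space A p = {v.
     (\<forall>f\<in>smooth_functions A. \<forall>h\<in>smooth_functions A. v (f + h) = v f + v h) \<and>
     (\<forall>f\<in>smooth_functions A. \<forall>r. v (r *\<^sub>R f) = r * v f) \<and>
     (\<forall>f\<in>smooth_functions A. \<forall>h\<in>smooth_functions A. v (f * h) = f p * v h + h p * v f) \<and>
     (\<forall>f. f \<notin> smooth_functions A \<longrightarrow> v f = 0)}"

definition vector_fields ::
    "('a set \<times> ('a \<Rightarrow> 'e::euclidean_space)) set \<Rightarrow> ('a \<Rightarrow> 'a tvec) set" where
  "vector_fields A = {X. (\<forall>p. X p \<in> tangent_space A p) \<and>
     (\<forall>f\<in>smooth_functions A. (\<lambda>p. X p f) \<in> smooth_functions A)}"

definition linear_map_on :: "'v::real_vector set \<Rightarrow> ('v \<Rightarrow> 'w::real_vector) \<Rightarrow> bool" where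
  "linear_map_on V L \<longleftrightarrow>
     (\<forall>v\<in>V. \<forall>w\<in>V. L (v + w) = L v + L w) \<and> (\<forall>r. \<forall>v\<in>V. L (r *\<^sub>R v) = r *\<^sub>R L v)"

definition endomorphism_field ::
    "('a set \<times> ('a \<Rightarrow> 'e::euclidean_space)) set \<Rightarrow> ('a \<Rightarrow> 'a tvec \<Rightarrow> 'a tvec) \<Rightarrow> bool" where
  "endomorphism_field A \<phi> \<longleftrightarrow>
     (\<forall>p. linear_map_on (tangent_space A p) (\<phi> p) \<and>
          \<phi> p ` tangent_space A p \<subseteq> tangent_space A p) \<and>
     (\<forall>X\<in>vector_fields A. (\<lambda>p. \<phi> p (X p)) \<in> vector_fields A)"

definition one_form ::
    "('a set \<times> ('a \<Rightarrow> 'e::euclidean_space)) set \<Rightarrow> ('a \<Rightarrow> 'a tvec \<Rightarrow> real) \<Rightarrow> bool" where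
  "one_form A \<eta> \<longleftrightarrow>
     (\<forall>p. linear_map_on (tangent_space A p) (\<eta> p)) \<and>
     (\<forall>X\<in>vector_fields A. (\<lambda>p. \<eta> p (X p)) \<in> smooth_functions A)"

definition riemannian_metric ::
    "('a set \<times> ('a \<Rightarrow> 'e::euclidean_space)) set \<Rightarrow> ('a \<Rightarrow> 'a tvec \<Rightarrow> 'a tvec \<Rightarrow> real) \<Rightarrow> bool" where
  "riemannian_metric A g \<longleftrightarrow>
     (\<forall>p. (\<forall>v\<in>tangent_space A p. linear_map_on (tangent_space A p) (g p v)) \<and>
          (\<forall>v\<in>tangent_space A p. \<forall>w\<in>tangent_space A p. g p v w = g p w v) \<and>
          (\<forall>v\<in>tangent_space A p. v \<noteq> 0 \<longrightarrow> g p v v > 0)) \<and>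
     (\<forall>X\<in>vector_fields A. \<forall>Y\<in>vector_fields A. (\<lambda>p. g p (X p) (Y p)) \<in> smooth_functions A)"

text \<open>
  Trace of an endomorphism of a finite-dimensional subspace, as the sum of the diagonal matrix
  entries with respect to a basis; the value does not depend on the basis chosen.
\<close>

definition trace_on :: "'v::real_vector set \<Rightarrow> ('v \<Rightarrow> 'v) \<Rightarrow> real" where
  "trace_on V L =
     (let B = (SOME B. independent B \<and> span B = V) in \<Sum>b\<in>B. representation B (L b) b)"

locale riemannian_Pi_manifold = smooth_manifold A
  for A :: "('a::{t2_space, second_countable_topology} set \<times> ('a \<Rightarrow> 'e::euclidean_space)) set" +
  fixes \<phi> :: "'a \<Rightarrow> 'a tvec \<Rightarrow> 'a tvec"
    and \<xi> :: "'a \<Rightarrow> 'a tvec"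
    and \<eta> :: "'a \<Rightarrow> 'a tvec \<Rightarrow> real"
    and g :: "'a \<Rightarrow> 'a tvec \<Rightarrow> 'a tvec \<Rightarrow> real"
  assumes dimension: "\<exists>n. DIM('e) = 2 * n + 1"
    and metric: "riemannian_metric A g"
    and endomorphism: "endomorphism_field A \<phi>"
    and field: "\<xi> \<in> vector_fields A"
    and form: "one_form A \<eta>"
    and phi_xi: "\<phi> p (\<xi> p) = 0"
    and phi_phi: "x \<in> tangent_space A p \<Longrightarrow> \<phi> p (\<phi> p x) = x - \<eta> p x *\<^sub>R \<xi> p"
    and eta_phi: "x \<in> tangent_space A p \<Longrightarrow> \<eta> p (\<phi> p x) = 0"
    and eta_xi: "\<eta> p (\<xi> p) = 1"
    and trace_phi: "trace_on (tangent_space A p) (\<phi> p) = 0"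
    and metric_phi: "x \<in> tangent_space A p \<Longrightarrow> y \<in> tangent_space A p \<Longrightarrow>
      g p (\<phi> p x) (\<phi> p y) = g p x y - \<eta> p x * \<eta> p y"

text \<open>
  Only the values of \<open>D\<close> on vector fields matter. Scaling by real constants in the second argument
  is the Leibniz rule for constant functions.
\<close>

definition affine_connection ::
    "('a set \<times> ('a \<Rightarrow> 'e::euclidean_space)) set \<Rightarrow>
     (('a \<Rightarrow> 'a tvec) \<Rightarrow> ('a \<Rightarrow> 'a tvec) \<Rightarrow> 'a \<Rightarrow> 'a tvec) \<Rightarrow> bool" where
  "affine_connection A D \<longleftrightarrow>
     (\<forall>X\<in>vector_fields A. \<forall>Y\<in>vector_fields A. D X Y \<in> vector_fields A) \<and>
     (\<forall>X\<in>vector_fields A. \<forall>X'\<in>vector_fields A. \<forall>Y\<in>vector_fields A.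
        D (X + X') Y = D X Y + D X' Y) \<and>
     (\<forall>f\<in>smooth_functions A. \<forall>X\<in>vector_fields A. \<forall>Y\<in>vector_fields A.
        D (\<lambda>p. f p *\<^sub>R X p) Y = (\<lambda>p. f p *\<^sub>R D X Y p)) \<and>
     (\<forall>X\<in>vector_fields A. \<forall>Y\<in>vector_fields A. \<forall>Y'\<in>vector_fields A.
        D X (Y + Y') = D X Y + D X Y') \<and>
     (\<forall>f\<in>smooth_functions A. \<forall>X\<in>vector_fields A. \<forall>Y\<in>vector_fields A.
        D X (\<lambda>p. f p *\<^sub>R Y p) = (\<lambda>p. X p f *\<^sub>R Y p + f p *\<^sub>R D X Y p))"

definition parallel_field ::
    "('a set \<times> ('a \<Rightarrow> 'e::euclidean_space)) set \<Rightarrow>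
     (('a \<Rightarrow> 'a tvec) \<Rightarrow> ('a \<Rightarrow> 'a tvec) \<Rightarrow> 'a \<Rightarrow> 'a tvec) \<Rightarrow> ('a \<Rightarrow> 'a tvec) \<Rightarrow> bool" where
  "parallel_field A D \<xi> \<longleftrightarrow> (\<forall>X\<in>vector_fields A. \<forall>p. D X \<xi> p = 0)"

text \<open>
  The covariant derivatives of the remaining tensor fields are the usual extensions of \<open>D\<close>:
  \<open>(D\<^sub>X \<phi>) Y\<close>, \<open>(D\<^sub>X \<eta>) Y\<close> and \<open>(D\<^sub>X g) (Y, Z)\<close>, evaluated at \<open>p\<close>.
\<close>

definition cov_endomorphism ::
    "(('a \<Rightarrow> 'a tvec) \<Rightarrow> ('a \<Rightarrow> 'a tvec) \<Rightarrow> 'a \<Rightarrow> 'a tvec) \<Rightarrow> ('a \<Rightarrow> 'a tvec \<Rightarrow> 'a tvec) \<Rightarrow>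
     ('a \<Rightarrow> 'a tvec) \<Rightarrow> ('a \<Rightarrow> 'a tvec) \<Rightarrow> 'a \<Rightarrow> 'a tvec" where
  "cov_endomorphism D \<phi> X Y p = D X (\<lambda>q. \<phi> q (Y q)) p - \<phi> p (D X Y p)"

definition cov_form ::
    "(('a \<Rightarrow> 'a tvec) \<Rightarrow> ('a \<Rightarrow> 'a tvec) \<Rightarrow> 'a \<Rightarrow> 'a tvec) \<Rightarrow> ('a \<Rightarrow> 'a tvec \<Rightarrow> real) \<Rightarrow>
     ('a \<Rightarrow> 'a tvec) \<Rightarrow> ('a \<Rightarrow> 'a tvec) \<Rightarrow> 'a \<Rightarrow> real" where
  "cov_form D \<eta> X Y p = X p (\<lambda>q. \<eta> q (Y q)) - \<eta> p (D X Y p)"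

definition cov_metric ::
    "(('a \<Rightarrow> 'a tvec) \<Rightarrow> ('a \<Rightarrow> 'a tvec) \<Rightarrow> 'a \<Rightarrow> 'a tvec) \<Rightarrow> ('a \<Rightarrow> 'a tvec \<Rightarrow> 'a tvec \<Rightarrow> real) \<Rightarrow>
     ('a \<Rightarrow> 'a tvec) \<Rightarrow> ('a \<Rightarrow> 'a tvec) \<Rightarrow> ('a \<Rightarrow> 'a tvec) \<Rightarrow> 'a \<Rightarrow> real" where
  "cov_metric D g X Y Z p =
     X p (\<lambda>q. g q (Y q) (Z q)) - g p (D X Y p) (Z p) - g p (Y p) (D X Z p)"

definition parallel_endomorphism ::
    "('a set \<times> ('a \<Rightarrow> 'e::euclidean_space)) set \<Rightarrow>
     (('a \<Rightarrow> 'a tvec) \<Rightarrow> ('a \<Rightarrow> 'a tvec) \<Rightarrow> 'a \<Rightarrow> 'a tvec) \<Rightarrow>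
     ('a \<Rightarrow> 'a tvec \<Rightarrow> 'a tvec) \<Rightarrow> bool" where
  "parallel_endomorphism A D \<phi> \<longleftrightarrow>
     (\<forall>X\<in>vector_fields A. \<forall>Y\<in>vector_fields A. \<forall>p. cov_endomorphism D \<phi> X Y p = 0)"

definition parallel_form ::
    "('a set \<times> ('a \<Rightarrow> 'e::euclidean_space)) set \<Rightarrow>
     (('a \<Rightarrow> 'a tvec) \<Rightarrow> ('a \<Rightarrow> 'a tvec) \<Rightarrow> 'a \<Rightarrow> 'a tvec) \<Rightarrow> ('a \<Rightarrow> 'a tvec \<Rightarrow> real) \<Rightarrow> bool" where
  "parallel_form A D \<eta> \<longleftrightarrow>
     (\<forall>X\<in>vector_fields A. \<forall>Y\<in>vector_fields A. \<forall>p. cov_form D \<eta> X Y p = 0)"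

definition parallel_metric ::
    "('a set \<times> ('a \<Rightarrow> 'e::euclidean_space)) set \<Rightarrow>
     (('a \<Rightarrow> 'a tvec) \<Rightarrow> ('a \<Rightarrow> 'a tvec) \<Rightarrow> 'a \<Rightarrow> 'a tvec) \<Rightarrow>
     ('a \<Rightarrow> 'a tvec \<Rightarrow> 'a tvec \<Rightarrow> real) \<Rightarrow> bool" where
  "parallel_metric A D g \<longleftrightarrow>
     (\<forall>X\<in>vector_fields A. \<forall>Y\<in>vector_fields A. \<forall>Z\<in>vector_fields A. \<forall>p.
        cov_metric D g X Y Z p = 0)"

definition natural_connection ::
    "('a set \<times> ('a \<Rightarrow> 'e::euclidean_space)) set \<Rightarrow> ('a \<Rightarrow> 'a tvec \<Rightarrow> 'a tvec) \<Rightarrow>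
     ('a \<Rightarrow> 'a tvec) \<Rightarrow> ('a \<Rightarrow> 'a tvec \<Rightarrow> real) \<Rightarrow> ('a \<Rightarrow> 'a tvec \<Rightarrow> 'a tvec \<Rightarrow> real) \<Rightarrow>
     (('a \<Rightarrow> 'a tvec) \<Rightarrow> ('a \<Rightarrow> 'a tvec) \<Rightarrow> 'a \<Rightarrow> 'a tvec) \<Rightarrow> bool" where
  "natural_connection A \<phi> \<xi> \<eta> g D \<longleftrightarrow>
     affine_connection A D \<and> parallel_endomorphism A D \<phi> \<and> parallel_field A D \<xi> \<and>
     parallel_form A D \<eta> \<and> parallel_metric A D g"

end

(*
  The identities of the structure give g(x, \<xi>) = \<eta>(x) and g(\<xi>, \<xi>) = 1. If D \<phi> = 0, then
  \<phi> (D\<^sub>X \<xi>) = D\<^sub>X (\<phi> \<xi>) = 0, so D\<^sub>X \<xi> is a multiple of \<xi>; if also D g = 0, differentiating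
  g(\<xi>, \<xi>) = 1 shows that D\<^sub>X \<xi> is orthogonal to \<xi>, hence zero. Since \<eta> = g(\<cdot>, \<xi>), D \<eta> = 0 follows.
*)
theory Submission
  imports Defs
begin

text \<open>\<open>linear_map_on\<close> constrains \<open>L\<close> only on elements of
  \<open>V\<close>, and \<open>V\<close> need not be a subspace, so a witness \<open>v\<close> is
  required; 0 enters as its multiple by the scalar 0.\<close>

lemma linear_map_on_zero:
  assumes "linear_map_on V L" "v \<in> V"
  shows "L 0 = 0"
proof -
  have "L (0 *\<^sub>R v) = 0 *\<^sub>R L v"
    using assms unfolding linear_map_on_def by blast
  then show ?thesis by simp
qed

text \<open>Derivations kill constants: the Leibniz rule for 1 = 1 * 1 doubles the value. Smoothness
  of 1 is what makes that rule available.\<close>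

lemma tangent_space_one:
  assumes "v \<in> tangent_space A p" "1 \<in> smooth_functions A"
  shows "v 1 = 0"
proof -
  have "v (1 * 1) = 1 p * v 1 + 1 p * v 1"
    using assms unfolding tangent_space_def by blast
  then show ?thesis by simp
qed

lemma vector_fields_tangent:
  "X \<in> vector_fields A \<Longrightarrow> X p \<in> tangent_space A p"
  by (simp add: vector_fields_def)

lemma affine_connection_closed:
  "affine_connection A D \<Longrightarrow> X \<in> vector_fields A \<Longrightarrow> Y \<in> vector_fields A \<Longrightarrow> D X Y \<in> vector_fields A"
  unfolding affine_connection_def by blast

lemma affine_connection_zero:
  assumes "affine_connection A D" "X \<in> vector_fields A" "0 \<in> vector_fields A"
  shows "D X 0 = 0"
proof -
  have "D X (0 + 0) = D X 0 + D X 0"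
    using assms unfolding affine_connection_def by blast
  then show ?thesis by simp
qed

context riemannian_Pi_manifold
begin

lemma xi_tangent: "\<xi> p \<in> tangent_space A p"
  using field by (rule vector_fields_tangent)

lemma phi_zero: "\<phi> p 0 = 0"
  using endomorphism xi_tangent linear_map_on_zero unfolding endomorphism_field_def by blast

lemma phi_tangent: "x \<in> tangent_space A p \<Longrightarrow> \<phi> p x \<in> tangent_space A p"
  using endomorphism unfolding endomorphism_field_def by blast

lemma metric_zero_right: "x \<in> tangent_space A p \<Longrightarrow> g p x 0 = 0"
  using metric linear_map_on_zero unfolding riemannian_metric_def by blast

lemma metric_commute:
  "x \<in> tangent_space A p \<Longrightarrow> y \<in> tangent_space A p \<Longrightarrow> g p x y = g p y x"
  using metric unfolding riemannian_metric_def by blast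

text \<open>Put y = \<xi> in the compatibility of g with \<phi>: the left side vanishes because
  \<phi> \<xi> = 0, and \<eta>(\<xi>) = 1 on the right.\<close>

lemma metric_xi: "x \<in> tangent_space A p \<Longrightarrow> g p x (\<xi> p) = \<eta> p x"
  using metric_phi[of x p "\<xi> p"] by (simp add: xi_tangent phi_xi eta_xi metric_zero_right phi_tangent)

text \<open>The zero field is \<phi> \<xi>, so membership follows from the structure tensors without
  any computation in charts.\<close>

lemma zero_vector_field: "0 \<in> vector_fields A"
proof -
  have "(\<lambda>p. \<phi> p (\<xi> p)) \<in> vector_fields A"
    using endomorphism field unfolding endomorphism_field_def by blast
  then show ?thesis by (simp add: phi_xi zero_fun_def)
qed

text \<open>Again no charts: the constant 1 is the function \<eta>(\<xi>).\<close>

lemma one_smooth: "1 \<in> smooth_functions A"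
proof -
  have "(\<lambda>p. \<eta> p (\<xi> p)) \<in> smooth_functions A"
    using form field unfolding one_form_def by blast
  then show ?thesis by (simp add: eta_xi one_fun_def)
qed

lemma parallel_xi:
  assumes D: "affine_connection A D"
    and phi: "parallel_endomorphism A D \<phi>" and g: "parallel_metric A D g"
  shows "parallel_field A D \<xi>"
  unfolding parallel_field_def
proof (intro ballI allI)
  fix X p assume X: "X \<in> vector_fields A"
  have T: "D X \<xi> p \<in> tangent_space A p"
    using affine_connection_closed[OF D X field] by (rule vector_fields_tangent)
  have "cov_endomorphism D \<phi> X \<xi> p = 0"
    using phi X field unfolding parallel_endomorphism_def by blast
  moreover have "(\<lambda>q. \<phi> q (\<xi> q)) = 0"
    by (rule ext) (simp only: phi_xi zero_fun_apply)
  ultimately have "\<phi> p (D X \<xi> p) = 0"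
    using affine_connection_zero[OF D X zero_vector_field] by (simp add: cov_endomorphism_def)
  \<comment> \<open>Apply \<phi> once more: 0 = \<open>\<phi> p 0\<close> is the value of \<phi>
    squared, hence of I - \<eta> \<otimes> \<xi>, at \<open>D X \<xi> p\<close>.\<close>
  then have vertical: "D X \<xi> p = \<eta> p (D X \<xi> p) *\<^sub>R \<xi> p"
    using phi_phi[OF T] by (simp add: phi_zero)
  have "cov_metric D g X \<xi> \<xi> p = 0"
    using g X field unfolding parallel_metric_def by blast
  moreover have "(\<lambda>q. g q (\<xi> q) (\<xi> q)) = 1"
    by (simp add: metric_xi xi_tangent eta_xi one_fun_def)
  moreover have "X p 1 = 0"
    using vector_fields_tangent[OF X] one_smooth by (rule tangent_space_one)
  \<comment> \<open>By symmetry of g both correction terms of \<open>cov_metric\<close> equal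
    \<eta>(\<open>D X \<xi> p\<close>), so twice this number is 0.\<close>
  ultimately have "\<eta> p (D X \<xi> p) = 0"
    using T by (simp add: cov_metric_def metric_commute[OF xi_tangent T] metric_xi)
  with vertical show "D X \<xi> p = 0" by simp
qed

text \<open>Replacing \<eta> by g(\<cdot>, \<xi>) gives (D \<eta>)(Y) = (D g)(Y, \<xi>) + g(Y, D
  \<xi>), all derivatives along X; both summands vanish.\<close>

lemma parallel_eta:
  assumes D: "affine_connection A D"
    and g: "parallel_metric A D g" and xi: "parallel_field A D \<xi>"
  shows "parallel_form A D \<eta>"
  unfolding parallel_form_def
proof (intro ballI allI)
  fix X Y p assume X: "X \<in> vector_fields A" and Y: "Y \<in> vector_fields A"
  have "cov_metric D g X Y \<xi> p = 0"
    using g X Y field unfolding parallel_metric_def by blast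
  moreover have "D X \<xi> p = 0"
    using xi X unfolding parallel_field_def by blast
  ultimately show "cov_form D \<eta> X Y p = 0"
    using affine_connection_closed[OF D X Y] Y
    by (simp add: cov_metric_def cov_form_def metric_xi metric_zero_right vector_fields_tangent)
qed

end

theorem theorem3p3:
  fixes A :: "('a::{t2_space, second_countable_topology} set \<times> ('a \<Rightarrow> 'e::euclidean_space)) set"
    and \<phi> :: "'a \<Rightarrow> 'a tvec \<Rightarrow> 'a tvec"
    and \<xi> :: "'a \<Rightarrow> 'a tvec"
    and \<eta> :: "'a \<Rightarrow> 'a tvec \<Rightarrow> real"
    and g :: "'a \<Rightarrow> 'a tvec \<Rightarrow> 'a tvec \<Rightarrow> real"
    and D :: "('a \<Rightarrow> 'a tvec) \<Rightarrow> ('a \<Rightarrow> 'a tvec) \<Rightarrow> 'a \<Rightarrow> 'a tvec"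
  assumes "riemannian_Pi_manifold A \<phi> \<xi> \<eta> g"
    and "affine_connection A D"
  shows "natural_connection A \<phi> \<xi> \<eta> g D \<longleftrightarrow>
           parallel_endomorphism A D \<phi> \<and> parallel_metric A D g"
proof -
  interpret riemannian_Pi_manifold A \<phi> \<xi> \<eta> g by fact
  show ?thesis
    using assms(2) parallel_xi parallel_eta unfolding natural_connection_def by blast
qed

end
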